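(* Let $f:\mathbb R^n\to\mathbb R$ be a Lipschitz function. Then the stretch set $\mathbf\Gamma(f)$ is closed and $(n+1)$-rectifiable.
   Context: For a Lipschitz function $u:\mathbb R^n\to\mathbb R$, $\operatorname{Lip}(u)$ denotes its best Lipschitz constant, i.e. the infimum of all $L>0$ such that $|u(x)-u(y)|\le L|x-y|$ for all $x,y$. The stretch set of $u$ is $$\mathbf\Gamma(u) := \{(x,y)\in\mathbb R^n\times\mathbb R^n : |u(x)-u(y)| = \operatorname{Lip}(u)\,|x-y|\}.$$ Let $E$ be an arbitrary subset of $\mathbb R^d$ and $k<d$ a nonzero integer. $E$ is $k$-rectifiable if there exist countably many Lipschitz maps $\psi_i:\mathbb R^k\to\mathbb R^d$ such that $E\subseteq\bigcup_i\psi_i(\mathbb R^k)$ (no exceptional $\mathcal H^k$-null set is allowed to be omitted). Here $\mathbf\Gamma(f)$ is a subset of $\mathbb R^n\times\mathbb R^n=\mathbb R^{2n}$.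
   Formalization: Rectifiability is claimed only when f is nonconstant or n = 1: for constant f and n ≥ 2 the stretch set is all of R^{2n}, which is not (n+1)-rectifiable. Closedness is claimed for every Lipschitz f. *)

theory Defs
  imports "HOL-Analysis.Analysis"
begin

text \<open>The best Lipschitz constant. It is meaningful only if \<open>u\<close> is Lipschitz, so that the set
  below is nonempty. The admissible \<open>L\<close> are positive, but the infimum is \<open>0\<close> for constant \<open>u\<close>.\<close>

definition Lip :: "('a::metric_space \<Rightarrow> real) \<Rightarrow> real" where
  "Lip u = Inf {L. L > 0 \<and> (\<forall>x y. \<bar>u x - u y\<bar> \<le> L * dist x y)}"

definition stretch_set :: "('a::metric_space \<Rightarrow> real) \<Rightarrow> ('a \<times> 'a) set" where
  "stretch_set u = {(x, y). \<bar>u x - u y\<bar> = Lip u * dist x y}"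

text \<open>\<open>rectifiable TYPE('k) E\<close> means that \<open>E\<close> is \<open>k\<close>-rectifiable for \<open>k = CARD('k)\<close>: it is covered,
  with no exceptional null set, by countably many Lipschitz images of the whole of \<open>\<real>\<^sup>k\<close>. Each map
  may have its own Lipschitz constant. The condition \<open>k < DIM('a)\<close> is not built in; for
  \<open>k \<ge> DIM('a)\<close> every set is rectifiable in this sense.\<close>

definition rectifiable :: "'k::finite itself \<Rightarrow> 'a::euclidean_space set \<Rightarrow> bool" where
  "rectifiable _ E \<longleftrightarrow>
     (\<exists>\<psi> :: nat \<Rightarrow> real ^ 'k \<Rightarrow> 'a.
        (\<forall>i. \<exists>L. L-lipschitz_on UNIV (\<psi> i)) \<and> E \<subseteq> (\<Union>i. range (\<psi> i)))"

end

theory Submission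
  imports Defs
begin

text \<open>
  Write \<open>L = Lip f\<close>. The best constant is attained, so \<open>f\<close> is \<open>L\<close>-Lipschitz
  (\<open>lipschitz_on_Lip\<close>) and the stretch set is closed, being cut out by an equation between
  continuous functions.

  Rectifiability comes from counting parameters. Let \<open>(x, y)\<close> be a pair with
  \<open>f y - f x = L * dist x y\<close> and \<open>x \<noteq> y\<close>. Fix a point \<open>z\<close> strictly between \<open>x\<close> and \<open>y\<close>, let \<open>e\<close> be the
  direction of the segment, and \<open>s\<close>, \<open>t\<close> the distances from \<open>z\<close> to its ends, so that
  \<open>x = z - s e\<close> and \<open>y = z + t e\<close>. If \<open>L > 0\<close>, the function \<open>f\<close> grows at the full rate \<open>L\<close> along the
  whole segment, and this makes \<open>e\<close> a Lipschitz function of \<open>z\<close> as long as \<open>s\<close> and \<open>t\<close> stay away from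
  \<open>0\<close> (\<open>steepest_directions_close\<close>): if two such segments had nearby centres and different directions,
  going from the tail of one to the head of the other would be shorter, but \<open>f\<close> would rise too much.
  Hence \<open>(x, y)\<close> is a Lipschitz function of \<open>(z, s, t)\<close>, which are \<open>n + 2\<close> parameters.
  One of them is saved by the choice of \<open>z\<close>. The segment is not orthogonal to
  all the coordinate axes, so it crosses some hyperplane on which one coordinate is a rational
  constant, and \<open>z\<close> is taken there. Countably many choices of the axis, of the rational number and of
  the bounds for \<open>s\<close> and \<open>t\<close> exhaust all the pairs. On each of the resulting pieces the Lipschitz
  dependence on the parameters extends to the whole parameter space by McShane's formula, which gives
  the Lipschitz maps that rectifiability asks for (\<open>rectifiable_lipschitz_relation\<close>).

  The pairs along which \<open>f\<close> decreases are covered by the same argument for \<open>- f\<close>.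
  The diagonal is a Lipschitz image of \<open>\<real>\<^sup>n\<close>. In dimension one, \<open>n + 1 = 2n\<close> and every subset of the
  product is rectifiable; this includes constant functions, for which \<open>L = 0\<close> and the stretch set is
  everything.
\<close>

section \<open>Extension of Lipschitz maps\<close>

text \<open>McShane's formula: the largest extension with the same constant is the lower envelope of the
  cones of slope \<open>C\<close> that stand on the graph.\<close>

lemma lipschitz_extension_real:
  fixes g :: "'a::metric_space \<Rightarrow> real"
  assumes g: "C-lipschitz_on A g"
  obtains h where "C-lipschitz_on UNIV h" "\<And>a. a \<in> A \<Longrightarrow> h a = g a"
proof (cases "A = {}")
  case True
  have "C-lipschitz_on UNIV (\<lambda>x::'a. 0::real)"
    using lipschitz_on_nonneg[OF g] by (auto intro!: lipschitz_onI)
  with True that show thesis by blast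
next
  case False
  have C: "C \<ge> 0" using lipschitz_on_nonneg[OF g] .
  define h where "h x = (INF a\<in>A. g a + C * dist x a)" for x
  have bdd: "bdd_below ((\<lambda>a. g a + C * dist x a) ` A)" for x
  proof -
    from False obtain a0 where a0: "a0 \<in> A" by blast
    have "g a0 - C * dist x a0 \<le> g a + C * dist x a" if "a \<in> A" for a
    proof -
      have "g a0 - g a \<le> C * dist a0 a"
        using lipschitz_onD[OF g a0 that] by (simp add: dist_real_def)
      also have "\<dots> \<le> C * (dist x a0 + dist x a)"
        using C by (intro mult_left_mono dist_triangle3)
      finally show ?thesis by (simp add: algebra_simps)
    qed
    then show ?thesis by (rule bdd_belowI2)
  qed
  have le: "h x \<le> h y + C * dist x y" for x y
  proof -
    have "h x - C * dist x y \<le> g a + C * dist y a" if "a \<in> A" for a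
    proof -
      have "h x \<le> g a + C * dist x a"
        unfolding h_def by (rule cINF_lower[OF bdd that])
      also have "C * dist x a \<le> C * (dist x y + dist y a)"
        using C by (intro mult_left_mono dist_triangle)
      finally show ?thesis by (simp add: algebra_simps)
    qed
    then have "h x - C * dist x y \<le> h y"
      unfolding h_def[of y] by (intro cINF_greatest False)
    then show ?thesis by simp
  qed
  have "C-lipschitz_on UNIV h"
  proof (rule lipschitz_onI[OF _ C])
    fix x y
    show "dist (h x) (h y) \<le> C * dist x y"
      using le[of x y] le[of y x] by (auto simp: dist_real_def dist_commute)
  qed
  moreover have "h a = g a" if a: "a \<in> A" for a
  proof (rule antisym)
    have "h a \<le> g a + C * dist a a"
      unfolding h_def by (rule cINF_lower[OF bdd a])
    then show "h a \<le> g a" by simp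
    have "g a \<le> g b + C * dist a b" if "b \<in> A" for b
      using lipschitz_onD[OF g a that] by (simp add: dist_real_def)
    then show "g a \<le> h a"
      unfolding h_def by (intro cINF_greatest False)
  qed
  ultimately show thesis using that by blast
qed

text \<open>Extending each coordinate separately may enlarge the constant, but rectifiability does
  not see its size.\<close>

lemma lipschitz_extension_euclidean:
  fixes g :: "'a::metric_space \<Rightarrow> 'b::euclidean_space"
  assumes g: "C-lipschitz_on A g"
  obtains D h where "D-lipschitz_on UNIV h" "\<And>a. a \<in> A \<Longrightarrow> h a = g a"
proof -
  have C: "C \<ge> 0" using lipschitz_on_nonneg[OF g] .
  have "\<exists>k. C-lipschitz_on UNIV k \<and> (\<forall>a\<in>A. k a = g a \<bullet> b)" if b: "b \<in> Basis" for b
  proof -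
    have "C-lipschitz_on A (\<lambda>x. g x \<bullet> b)"
    proof (rule lipschitz_onI[OF _ C])
      fix x y assume "x \<in> A" "y \<in> A"
      then have "dist (g x) (g y) \<le> C * dist x y" using lipschitz_onD[OF g] by blast
      then show "dist (g x \<bullet> b) (g y \<bullet> b) \<le> C * dist x y"
        using Basis_le_norm[OF b, of "g x - g y"]
        by (simp add: dist_norm inner_diff_left)
    qed
    then show ?thesis by (rule lipschitz_extension_real) blast
  qed
  then have "\<exists>k. \<forall>b\<in>Basis. C-lipschitz_on UNIV (k b) \<and> (\<forall>a\<in>A. k b a = g a \<bullet> b)"
    by (intro bchoice ballI)
  then obtain k where k: "\<And>b. b \<in> Basis \<Longrightarrow> C-lipschitz_on UNIV (k b)"
    and kg: "\<And>a b. b \<in> Basis \<Longrightarrow> a \<in> A \<Longrightarrow> k b a = g a \<bullet> b"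
    by blast
  define h where "h x = (\<Sum>b\<in>Basis. k b x *\<^sub>R b)" for x
  have "(real DIM('b) * C)-lipschitz_on UNIV h"
  proof (rule lipschitz_onI)
    fix x y
    have "dist (h x) (h y) = norm (\<Sum>b\<in>Basis. (k b x - k b y) *\<^sub>R b)"
      by (simp add: h_def dist_norm sum_subtractf scaleR_diff_left)
    also have "\<dots> \<le> (\<Sum>b\<in>(Basis::'b set). C * dist x y)"
    proof (rule sum_norm_le)
      fix b :: 'b assume "b \<in> Basis"
      then show "norm ((k b x - k b y) *\<^sub>R b) \<le> C * dist x y"
        using lipschitz_onD[OF k, of b x y] by (simp add: dist_real_def)
    qed
    finally show "dist (h x) (h y) \<le> real DIM('b) * C * dist x y" by simp
  qed (use C in simp)
  moreover have "h a = g a" if "a \<in> A" for a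
    using that by (simp add: h_def kg euclidean_representation)
  ultimately show thesis using that by blast
qed

section \<open>Rectifiable sets\<close>

lemma rectifiable_subset:
  "rectifiable TYPE('k::finite) F \<Longrightarrow> E \<subseteq> F \<Longrightarrow> rectifiable TYPE('k) E"
  unfolding rectifiable_def by blast

lemma rectifiable_UN:
  assumes "countable I" and "\<And>i. i \<in> I \<Longrightarrow> rectifiable TYPE('k::finite) (E i)"
  shows "rectifiable TYPE('k) (\<Union>i\<in>I. E i)"
proof (cases "I = {}")
  case True
  have "\<exists>L. L-lipschitz_on UNIV (\<lambda>x::real^'k. 0::'b)"
    by (rule exI) (rule lipschitz_on_constant)
  with True show ?thesis unfolding rectifiable_def by auto
next
  case False
  from assms(2) obtain \<psi> where
    lip: "\<And>i j. i \<in> I \<Longrightarrow> \<exists>L. L-lipschitz_on UNIV (\<psi> i j :: real^'k \<Rightarrow> 'b)"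
    and cover: "\<And>i. i \<in> I \<Longrightarrow> E i \<subseteq> (\<Union>j::nat. range (\<psi> i j))"
    unfolding rectifiable_def by metis
  define \<phi> where "\<phi> n = (case prod_decode n of (i, j) \<Rightarrow> \<psi> (from_nat_into I i) j)" for n
  have "\<exists>L. L-lipschitz_on UNIV (\<phi> n)" for n
    using lip from_nat_into[OF False] by (simp add: \<phi>_def split: prod.split)
  moreover have "(\<Union>i\<in>I. E i) \<subseteq> (\<Union>n. range (\<phi> n))"
  proof
    fix x assume "x \<in> (\<Union>i\<in>I. E i)"
    then obtain i j where "i \<in> I" "x \<in> range (\<psi> i j)" using cover by blast
    then have "x \<in> range (\<phi> (prod_encode (to_nat_on I i, j)))"
      by (simp add: \<phi>_def from_nat_into_to_nat_on[OF assms(1)])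
    then show "x \<in> (\<Union>n. range (\<phi> n))" by blast
  qed
  ultimately show ?thesis unfolding rectifiable_def by blast
qed

lemma rectifiable_Un:
  assumes "rectifiable TYPE('k::finite) E" "rectifiable TYPE('k) F"
  shows "rectifiable TYPE('k) (E \<union> F)"
  using rectifiable_UN[of "{E, F}" "\<lambda>X. X"] assms by auto

text \<open>A Lipschitz parametrization may be given by any relation between parameters and points, since
  the Lipschitz estimate itself makes the relation single-valued. Its
  parameters may range over an arbitrary part of any \<open>k\<close>-dimensional Euclidean space.\<close>

lemma rectifiable_lipschitz_relation:
  fixes R :: "'b::euclidean_space \<Rightarrow> 'a::euclidean_space \<Rightarrow> bool"
  assumes dim: "DIM('b) = CARD('k::finite)" and C: "C \<ge> 0"
    and R: "\<And>p q p' q'. R p q \<Longrightarrow> R p' q' \<Longrightarrow> dist q q' \<le> C * dist p p'"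
  shows "rectifiable TYPE('k) {q. \<exists>p. R p q}"
proof -
  define g where "g p = (SOME q. R p q)" for p
  have Rg: "R p (g p)" if "R p q" for p q
    unfolding g_def using that by (rule someI)
  have g_eq: "g p = q" if "R p q" for p q
    using R[OF Rg[OF that] that] by simp
  have "C-lipschitz_on {p. \<exists>q. R p q} g"
    by (rule lipschitz_onI[OF _ C]) (use R Rg in blast)
  then obtain D h where h: "D-lipschitz_on UNIV h" "\<And>p. p \<in> {p. \<exists>q. R p q} \<Longrightarrow> h p = g p"
    using lipschitz_extension_euclidean by blast
  from dim have "DIM(real^'k) = DIM('b)" by simp
  then obtain u :: "real^'k \<Rightarrow> 'b" and v where u: "linear u" "\<And>x. norm (u x) = norm x"
    and uv: "\<And>y. u (v y) = y"
    using isomorphisms_UNIV_UNIV by metis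
  have "1-lipschitz_on UNIV u"
    by (rule lipschitz_onI) (simp_all add: dist_norm linear_diff[OF u(1), symmetric] u(2))
  then have "(D * 1)-lipschitz_on UNIV (h \<circ> u)"
    by (intro lipschitz_on_compose lipschitz_on_subset[OF h(1)]) auto
  moreover have "{q. \<exists>p. R p q} \<subseteq> range (h \<circ> u)"
  proof
    fix q assume "q \<in> {q. \<exists>p. R p q}"
    then obtain p where "R p q" by blast
    then have "(h \<circ> u) (v p) = q" using h(2) g_eq uv by auto
    then show "q \<in> range (h \<circ> u)" by (metis rangeI)
  qed
  ultimately show ?thesis
    unfolding rectifiable_def by (intro exI[of _ "\<lambda>_. h \<circ> u"]) auto
qed

section \<open>Segments of steepest growth\<close>

text \<open>The reason is the parallelogram law. Adding the two growths, \<open>f\<close> rises by at least \<open>4 \<delta> L\<close>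
  in total from \<open>z - \<delta> e\<close> to \<open>z' + \<delta> e'\<close> and from \<open>z' - \<delta> e'\<close> to \<open>z + \<delta> e\<close>, so the sum of these two
  distances is at least \<open>4 \<delta>\<close>. With \<open>h = z' - z\<close> and \<open>u = e + e'\<close> they are the norms of
  \<open>\<delta> u + h\<close> and \<open>\<delta> u - h\<close>, whence \<open>4 \<delta>\<^sup>2 \<le> \<delta>\<^sup>2 |u|\<^sup>2 + |h|\<^sup>2\<close>, and \<open>|u|\<^sup>2 = 4 - |e - e'|\<^sup>2\<close>.\<close>

lemma steepest_directions_close:
  fixes f :: "'a::real_inner \<Rightarrow> real"
  assumes f: "L-lipschitz_on UNIV f" and "L > 0" "\<delta> > 0"
    and e: "norm e = 1" "norm e' = 1"
    and growth: "f (z + \<delta> *\<^sub>R e) - f (z - \<delta> *\<^sub>R e) \<ge> 2 * \<delta> * L"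
      "f (z' + \<delta> *\<^sub>R e') - f (z' - \<delta> *\<^sub>R e') \<ge> 2 * \<delta> * L"
  shows "\<delta> * norm (e - e') \<le> norm (z - z')"
proof -
  define h where "h = z' - z"
  define u where "u = \<delta> *\<^sub>R (e + e')"
  define A where "A = norm (u + h)"
  define B where "B = norm (u - h)"
  have f_le: "f p - f q \<le> L * norm (p - q)" for p q
    using lipschitz_onD[OF f, of p q] by (simp add: dist_norm)
  have "f (z' + \<delta> *\<^sub>R e') - f (z - \<delta> *\<^sub>R e) \<le> L * A"
    using f_le[of "z' + \<delta> *\<^sub>R e'" "z - \<delta> *\<^sub>R e"] by (simp add: A_def u_def h_def algebra_simps)
  moreover have "f (z + \<delta> *\<^sub>R e) - f (z' - \<delta> *\<^sub>R e') \<le> L * B"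
    using f_le[of "z + \<delta> *\<^sub>R e" "z' - \<delta> *\<^sub>R e'"] by (simp add: B_def u_def h_def algebra_simps)
  ultimately have "L * (4 * \<delta>) \<le> L * (A + B)"
    using growth by (simp add: algebra_simps)
  with \<open>L > 0\<close> have AB: "4 * \<delta> \<le> A + B" by simp
  have "(4 * \<delta>)\<^sup>2 \<le> (A + B)\<^sup>2"
    using AB \<open>\<delta> > 0\<close> by (intro power_mono) auto
  also have "\<dots> \<le> 2 * (A\<^sup>2 + B\<^sup>2)"
    using zero_le_power2[of "A - B"] by (simp add: power2_eq_square algebra_simps)
  also have "A\<^sup>2 + B\<^sup>2 = 2 * (norm u)\<^sup>2 + 2 * (norm h)\<^sup>2"
    by (simp add: A_def B_def power2_norm_eq_inner algebra_simps inner_commute)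
  finally have "4 * \<delta>\<^sup>2 \<le> (norm u)\<^sup>2 + (norm h)\<^sup>2"
    by (simp add: power2_eq_square)
  moreover have "(norm u)\<^sup>2 = \<delta>\<^sup>2 * (4 - (norm (e - e'))\<^sup>2)"
  proof -
    have "e \<bullet> e = 1" "e' \<bullet> e' = 1" using e by (simp_all add: norm_eq_1)
    then have "(norm (e + e'))\<^sup>2 = 4 - (norm (e - e'))\<^sup>2"
      by (simp add: power2_norm_eq_inner algebra_simps inner_commute)
    then show ?thesis by (simp add: u_def power_mult_distrib del: scaleR_add_right)
  qed
  ultimately have "(\<delta> * norm (e - e'))\<^sup>2 \<le> (norm h)\<^sup>2"
    by (simp add: power_mult_distrib algebra_simps)
  then have "\<delta> * norm (e - e') \<le> norm h" by (rule power2_le_imp_le) simp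
  then show ?thesis by (simp add: h_def norm_minus_commute)
qed

text \<open>Growth at the maximal rate is inherited by subsegments: the two pieces that are cut off cannot
  contribute more than their share.\<close>

lemma steepest_growth_subsegment:
  fixes f :: "'a::real_normed_vector \<Rightarrow> real"
  assumes f: "L-lipschitz_on UNIV f" and e: "norm e = 1"
    and st: "\<delta> \<le> s" "\<delta> \<le> t"
    and growth: "f (z + t *\<^sub>R e) - f (z - s *\<^sub>R e) = L * (s + t)"
  shows "f (z + \<delta> *\<^sub>R e) - f (z - \<delta> *\<^sub>R e) \<ge> 2 * \<delta> * L"
proof -
  have f_le: "f (z + a *\<^sub>R e) - f (z + b *\<^sub>R e) \<le> L * (a - b)" if "b \<le> a" for a b
    using lipschitz_onD[OF f, of "z + a *\<^sub>R e" "z + b *\<^sub>R e"] that e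
    by (simp add: dist_norm scaleR_diff_left[symmetric])
  show ?thesis
    using f_le[OF st(2)] f_le[of "- s" "- \<delta>"] st(1) growth by (simp add: algebra_simps)
qed

text \<open>One hyperplane and one bound \<open>m\<close>. On the hyperplane \<open>z \<bullet> b = q\<close> the coordinate along \<open>b\<close> carries
  no information about \<open>z\<close>, so the parameter \<open>p\<close> stores \<open>s\<close> in it.\<close>

definition steepest_piece ::
  "('a::euclidean_space \<Rightarrow> real) \<Rightarrow> real \<Rightarrow> 'a \<Rightarrow> real \<Rightarrow> real \<Rightarrow> 'a \<times> real \<Rightarrow> 'a \<times> 'a \<Rightarrow> bool" where
  "steepest_piece f L b q m p w \<longleftrightarrow>
     (\<exists>z e s t. p = (z + (s - q) *\<^sub>R b, t) \<and> w = (z - s *\<^sub>R e, z + t *\<^sub>R e) \<and> z \<bullet> b = q \<and> norm e = 1 \<and>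
        s \<in> {1/m..m} \<and> t \<in> {1/m..m} \<and> f (z + t *\<^sub>R e) - f (z - s *\<^sub>R e) = L * (s + t))"

lemma steepest_piece_lipschitz:
  fixes f :: "'a::euclidean_space \<Rightarrow> real"
  assumes f: "L-lipschitz_on UNIV f" and L: "L > 0" and m: "m > 0" and b: "b \<in> Basis"
    and w: "steepest_piece f L b q m p w" and w': "steepest_piece f L b q m p' w'"
  shows "dist w w' \<le> (6 + 4 * m\<^sup>2) * dist p p'"
proof -
  from w obtain z e s t where p: "p = (z + (s - q) *\<^sub>R b, t)"
    and w_eq: "w = (z - s *\<^sub>R e, z + t *\<^sub>R e)" and z: "z \<bullet> b = q" and e: "norm e = 1"
    and s: "s \<in> {1/m..m}" and t: "t \<in> {1/m..m}"
    and growth: "f (z + t *\<^sub>R e) - f (z - s *\<^sub>R e) = L * (s + t)"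
    unfolding steepest_piece_def by blast
  from w' obtain z' e' s' t' where p': "p' = (z' + (s' - q) *\<^sub>R b, t')"
    and w'_eq: "w' = (z' - s' *\<^sub>R e', z' + t' *\<^sub>R e')" and z': "z' \<bullet> b = q" and e': "norm e' = 1"
    and s': "s' \<in> {1/m..m}" and t': "t' \<in> {1/m..m}"
    and growth': "f (z' + t' *\<^sub>R e') - f (z' - s' *\<^sub>R e') = L * (s' + t')"
    unfolding steepest_piece_def by blast
  define P where "P = dist p p'"
  have fst_le: "norm (fst p - fst p') \<le> P"
    unfolding P_def using dist_fst_le[of p p'] by (simp add: dist_norm)
  have tt: "\<bar>t - t'\<bar> \<le> P"
    unfolding P_def using dist_snd_le[of p p'] by (simp add: dist_real_def p p')
  have "(fst p - fst p') \<bullet> b = s - s'"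
    using b by (simp add: p p' z z' inner_diff_left inner_add_left)
  then have ss: "\<bar>s - s'\<bar> \<le> P"
    using Basis_le_norm[OF b, of "fst p - fst p'"] fst_le by simp
  have "z - z' = (fst p - fst p') - (s - s') *\<^sub>R b"
    by (simp add: p p' algebra_simps)
  also have "norm \<dots> \<le> norm (fst p - fst p') + norm ((s - s') *\<^sub>R b)" by (rule norm_triangle_ineq4)
  also have "\<dots> \<le> 2 * P" using fst_le ss b by simp
  finally have zz: "norm (z - z') \<le> 2 * P" .
  have "1 / m * norm (e - e') \<le> norm (z - z')"
    using s t s' t' m
    by (intro steepest_directions_close[OF f L _ e e']
        steepest_growth_subsegment[OF f e _ _ growth] steepest_growth_subsegment[OF f e' _ _ growth'])
      auto
  then have "norm (e - e') \<le> m * norm (z - z')"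
    using m by (simp add: field_simps)
  also have "\<dots> \<le> m * (2 * P)"
    using zz m by (intro mult_left_mono) auto
  finally have ee: "norm (e - e') \<le> m * (2 * P)" .
  have scaled: "norm (a *\<^sub>R e - a' *\<^sub>R e') \<le> P + m * (m * (2 * P))"
    if "\<bar>a - a'\<bar> \<le> P" "\<bar>a'\<bar> \<le> m" for a a'
  proof -
    have "norm (a *\<^sub>R e - a' *\<^sub>R e') = norm ((a - a') *\<^sub>R e + a' *\<^sub>R (e - e'))"
      by (simp add: algebra_simps)
    also have "\<dots> \<le> \<bar>a - a'\<bar> + \<bar>a'\<bar> * norm (e - e')"
      using norm_triangle_ineq[of "(a - a') *\<^sub>R e" "a' *\<^sub>R (e - e')"] e by simp
    also have "\<dots> \<le> P + m * (m * (2 * P))"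
      using that ee m by (intro add_mono mult_mono) auto
    finally show ?thesis .
  qed
  have "0 \<le> 1 / m" using m by simp
  then have "0 \<le> s'" "0 \<le> t'" using s' t' by (meson atLeastAtMost_iff order_trans)+
  then have m': "\<bar>s'\<bar> \<le> m" "\<bar>t'\<bar> \<le> m" using s' t' by auto
  have "norm ((z - s *\<^sub>R e) - (z' - s' *\<^sub>R e')) \<le> norm (z - z') + norm (s *\<^sub>R e - s' *\<^sub>R e')"
    using norm_triangle_ineq4[of "z - z'" "s *\<^sub>R e - s' *\<^sub>R e'"] by (simp add: algebra_simps)
  then have x: "norm (fst w - fst w') \<le> 3 * P + 2 * m\<^sup>2 * P"
    using scaled[OF ss m'(1)] zz by (simp add: w_eq w'_eq power2_eq_square algebra_simps)
  have "norm ((z + t *\<^sub>R e) - (z' + t' *\<^sub>R e')) \<le> norm (z - z') + norm (t *\<^sub>R e - t' *\<^sub>R e')"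
    using norm_triangle_ineq[of "z - z'" "t *\<^sub>R e - t' *\<^sub>R e'"] by (simp add: algebra_simps)
  then have y: "norm (snd w - snd w') \<le> 3 * P + 2 * m\<^sup>2 * P"
    using scaled[OF tt m'(2)] zz by (simp add: w_eq w'_eq power2_eq_square algebra_simps)
  have "dist w w' \<le> norm (fst w - fst w') + norm (snd w - snd w')"
    using norm_Pair_le[of "fst w - fst w'" "snd w - snd w'"]
    by (simp add: dist_norm fst_diff[symmetric] snd_diff[symmetric] del: fst_diff snd_diff)
  with x y show ?thesis unfolding P_def by (simp add: algebra_simps)
qed

lemma steepest_pair_in_piece:
  fixes f :: "'a::euclidean_space \<Rightarrow> real"
  assumes xy: "f y - f x = L * dist x y" and "x \<noteq> y"
  obtains b r n p where "b \<in> Basis" "steepest_piece f L b (real_of_rat r) (real (Suc n)) p (x, y)"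
proof -
  from \<open>x \<noteq> y\<close> obtain b where b: "b \<in> Basis" and xyb: "x \<bullet> b \<noteq> y \<bullet> b"
    by (metis euclidean_eqI)
  then have "min (x \<bullet> b) (y \<bullet> b) < max (x \<bullet> b) (y \<bullet> b)" by auto
  then obtain r where r: "min (x \<bullet> b) (y \<bullet> b) < real_of_rat r" "real_of_rat r < max (x \<bullet> b) (y \<bullet> b)"
    using of_rat_dense by blast
  define q where "q = real_of_rat r"
  define \<theta> where "\<theta> = (q - x \<bullet> b) / (y \<bullet> b - x \<bullet> b)"
  have \<theta>: "0 < \<theta>" "\<theta> < 1"
    using r xyb by (auto simp: \<theta>_def q_def min_def max_def divide_simps split: if_splits)
  define d where "d = norm (y - x)"
  have d: "d > 0" using \<open>x \<noteq> y\<close> by (simp add: d_def)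
  define e where "e = (y - x) /\<^sub>R d"
  have e: "norm e = 1" "y - x = d *\<^sub>R e" using d by (simp_all add: e_def d_def)
  define s where "s = \<theta> * d"
  define t where "t = (1 - \<theta>) * d"
  define z where "z = x + s *\<^sub>R e"
  have st: "s > 0" "t > 0" "s + t = d" using \<theta> d by (auto simp: s_def t_def algebra_simps)
  have x: "x = z - s *\<^sub>R e" by (simp add: z_def)
  have "y = x + d *\<^sub>R e" using e(2) by (simp add: algebra_simps)
  then have y: "y = z + t *\<^sub>R e" by (simp add: z_def st(3)[symmetric] algebra_simps)
  have "z = x + \<theta> *\<^sub>R (y - x)" by (simp add: z_def s_def e(2))
  then have "z \<bullet> b = x \<bullet> b + \<theta> * (y \<bullet> b - x \<bullet> b)" by (simp add: inner_add_left inner_diff_left)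
  then have z: "z \<bullet> b = q" using xyb by (simp add: \<theta>_def)
  obtain n where n: "max (max s t) (max (1/s) (1/t)) < real n"
    using reals_Archimedean2 by blast
  have bounds: "a \<in> {1 / real (Suc n)..real (Suc n)}" if "a > 0" "a < real n" "1/a < real n" for a
  proof -
    have "1 / a < real (Suc n)" using that by simp
    then show ?thesis using that by (simp add: field_simps)
  qed
  have "f y - f x = L * (s + t)"
    using xy st(3) by (simp add: d_def dist_norm norm_minus_commute)
  then have growth: "f (z + t *\<^sub>R e) - f (z - s *\<^sub>R e) = L * (s + t)"
    by (simp add: x[symmetric] y[symmetric])
  have "s \<in> {1 / real (Suc n)..real (Suc n)}" "t \<in> {1 / real (Suc n)..real (Suc n)}"
    using bounds n st by auto
  with growth z e(1) x y
  have "steepest_piece f L b q (real (Suc n)) (z + (s - q) *\<^sub>R b, t) (x, y)"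
    unfolding steepest_piece_def by blast
  with b that show thesis unfolding q_def by blast
qed

lemma rectifiable_steepest_pairs:
  fixes f :: "'a::euclidean_space \<Rightarrow> real"
  assumes f: "L-lipschitz_on UNIV f" and L: "L > 0" and dim: "CARD('k::finite) = DIM('a) + 1"
  shows "rectifiable TYPE('k) {(x, y). f y - f x = L * dist x y}"
proof -
  have dim': "DIM('a \<times> real) = CARD('k)" using dim by simp
  define piece where
    "piece = (\<lambda>(b, r, n). {w. \<exists>p. steepest_piece f L b (real_of_rat r) (real (Suc n)) p w})"
  define I where "I = (Basis :: 'a set) \<times> (UNIV :: (rat \<times> nat) set)"
  have "countable I"
    unfolding I_def by (intro countable_SIGMA) (auto intro: countable_finite)
  moreover have "rectifiable TYPE('k) (piece i)" if i_in: "i \<in> I" for i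
  proof -
    obtain b r n where i: "i = (b, r, n)" and b: "b \<in> Basis" using i_in by (auto simp: I_def)
    show ?thesis unfolding piece_def i split
      by (rule rectifiable_lipschitz_relation[OF dim' _ steepest_piece_lipschitz[OF f L _ b]]) auto
  qed
  ultimately have pieces: "rectifiable TYPE('k) (\<Union>i\<in>I. piece i)"
    by (rule rectifiable_UN)
  have diagonal: "rectifiable TYPE('k) {w. \<exists>p::'a \<times> real. w = (fst p, fst p)}"
  proof (rule rectifiable_lipschitz_relation[OF dim', where C = 2])
    fix p p' :: "'a \<times> real" and w w' :: "'a \<times> 'a"
    assume "w = (fst p, fst p)" "w' = (fst p', fst p')"
    then have "dist w w' \<le> dist (fst p) (fst p') + dist (fst p) (fst p')"
      using norm_Pair_le[of "fst p - fst p'" "fst p - fst p'"] by (simp add: dist_norm)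
    then show "dist w w' \<le> 2 * dist p p'" using dist_fst_le[of p p'] by simp
  qed simp
  have "(x, y) \<in> (\<Union>i\<in>I. piece i) \<union> {w. \<exists>p::'a \<times> real. w = (fst p, fst p)}"
    if xy: "f y - f x = L * dist x y" for x y
  proof (cases "x = y")
    case True
    then show ?thesis by auto
  next
    case False
    obtain b r n p where
      "b \<in> Basis" "steepest_piece f L b (real_of_rat r) (real (Suc n)) p (x, y)"
      by (rule steepest_pair_in_piece[OF xy False])
    then have "(b, r, n) \<in> I" "(x, y) \<in> piece (b, r, n)"
      unfolding I_def piece_def by blast+
    then show ?thesis by blast
  qed
  then show ?thesis
    by (intro rectifiable_subset[OF rectifiable_Un[OF pieces diagonal]]) blast
qed

section \<open>The stretch set\<close>

lemma lipschitz_on_Lip: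
  fixes u :: "'a::metric_space \<Rightarrow> real"
  assumes "\<exists>L. L-lipschitz_on UNIV u"
  shows "(Lip u)-lipschitz_on UNIV u"
proof -
  define S where "S = {L. L > 0 \<and> (\<forall>x y. \<bar>u x - u y\<bar> \<le> L * dist x y)}"
  from assms obtain L where L: "L-lipschitz_on UNIV u" by blast
  have "\<bar>u x - u y\<bar> \<le> max L 1 * dist x y" for x y
    using lipschitz_onD[OF L, of x y] mult_right_mono[of L "max L 1" "dist x y"]
    by (simp add: dist_real_def)
  then have "max L 1 \<in> S" by (simp add: S_def)
  then have ne: "S \<noteq> {}" by blast
  have Lip: "Lip u = Inf S" by (simp add: Lip_def S_def)
  show ?thesis
  proof (rule lipschitz_onI)
    show "0 \<le> Lip u" unfolding Lip by (rule cInf_greatest[OF ne]) (simp add: S_def)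
    fix x y
    show "dist (u x) (u y) \<le> Lip u * dist x y"
    proof (cases "x = y")
      case False
      have "\<bar>u x - u y\<bar> / dist x y \<le> Lip u"
        unfolding Lip
        by (rule cInf_greatest[OF ne]) (use False in \<open>simp add: S_def divide_simps\<close>)
      then show ?thesis using False by (simp add: dist_real_def divide_simps)
    qed simp
  qed
qed

lemma closed_stretch_set:
  assumes "\<exists>L. L-lipschitz_on UNIV u"
  shows "closed (stretch_set u)"
proof -
  have c: "continuous_on UNIV u"
    using assms lipschitz_on_continuous_on by blast
  have eq: "stretch_set u = {p. \<bar>u (fst p) - u (snd p)\<bar> = Lip u * dist (fst p) (snd p)}"
    by (auto simp: stretch_set_def)
  show ?thesis unfolding eq
    by (intro closed_Collect_eq continuous_intros continuous_on_compose2[OF c]) auto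
qed

lemma Lip_pos:
  assumes "\<exists>L. L-lipschitz_on UNIV u" "\<not> u constant_on UNIV"
  shows "Lip u > 0"
proof (rule ccontr)
  assume "\<not> Lip u > 0"
  then have "Lip u = 0" using lipschitz_on_nonneg[OF lipschitz_on_Lip[OF assms(1)]] by simp
  then have "u x = u y" for x y
    using lipschitz_onD[OF lipschitz_on_Lip[OF assms(1)], of x y] by simp
  with assms(2) show False unfolding constant_on_def by blast
qed

theorem theorem2:
  fixes f :: "real ^ 'n \<Rightarrow> real"
  assumes "\<exists>L. L-lipschitz_on UNIV f"
    and "CARD('k::finite) = CARD('n) + 1"
  shows "closed (stretch_set f) \<and>
    (CARD('n) = 1 \<or> \<not> f constant_on UNIV \<longrightarrow> rectifiable TYPE('k) (stretch_set f))"
proof (intro conjI impI)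
  show "closed (stretch_set f)" using assms(1) by (rule closed_stretch_set)
  assume "CARD('n) = 1 \<or> \<not> f constant_on UNIV"
  then show "rectifiable TYPE('k) (stretch_set f)"
  proof
    assume "CARD('n) = 1"
    then have "DIM((real^'n) \<times> (real^'n)) = CARD('k)" using assms(2) by simp
    then have "rectifiable TYPE('k) {w. \<exists>p::(real^'n) \<times> (real^'n). p = w}"
      by (rule rectifiable_lipschitz_relation[where C = 1]) auto
    then show ?thesis by (rule rectifiable_subset) auto
  next
    assume nc: "\<not> f constant_on UNIV"
    note L = lipschitz_on_Lip[OF assms(1)] and pos = Lip_pos[OF assms(1) nc]
    have dim: "CARD('k) = DIM(real^'n) + 1" using assms(2) by simp
    have "rectifiable TYPE('k) {(x, y). f y - f x = Lip f * dist x y}"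
      by (rule rectifiable_steepest_pairs[OF L pos dim])
    moreover have "rectifiable TYPE('k) {(x, y). - f y - - f x = Lip f * dist x y}"
      by (rule rectifiable_steepest_pairs[OF _ pos dim]) (use L in simp)
    ultimately have "rectifiable TYPE('k) ({(x, y). f y - f x = Lip f * dist x y} \<union>
        {(x, y). - f y - - f x = Lip f * dist x y})"
      by (rule rectifiable_Un)
    then show ?thesis
      by (rule rectifiable_subset) (auto simp: stretch_set_def abs_if split: if_splits)
  qed
qed

end
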